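(* Let $n\ge1$ and let $V=\mathbb{R}^{n+1}$ with the quadratic form $Q(x)=x_1^2+\dotsb+x_n^2-x_{n+1}^2$. Let $f\in O_+(V)$. The interval $[\mathrm{id},f]$ in $O_+(V)$ is isomorphic (as a poset) to the poset, ordered by inclusion, of linear subspaces $U\subseteq\mathrm{Mov}(f)$ such that $\det(\chi_f|_U)>0$.
   Context: Let $\beta(u,v)=Q(u+v)-Q(u)-Q(v)$. $O(V)$ is the group of $f\in\mathrm{GL}(V)$ with $Q(f(u))=Q(u)$ for all $u$. The moved space of $f$ is $\mathrm{Mov}(f)=\mathrm{im}(\mathrm{id}-f)$. The Wall form of $f$ is the non-degenerate (not necessarily symmetric) bilinear form $\chi_f$ on $\mathrm{Mov}(f)$ given by $\chi_f(u,v)=\beta(w,v)$, where $w\in V$ is any vector with $u=w-f(w)$. For a subspace $U\subseteq\mathrm{Mov}(f)$, $\det(\chi_f|_U)$ is the determinant of the matrix of $\chi_f|_U$ in any basis of $U$; its sign does not depend on the basis, and it is $1$ for $U=\{0\}$. $f$ is positive if $\det(\chi_f)>0$ (i.e. its spinor norm is positive), and $O_+(V)$ is the subgroup of positive isometries. A positive reflection is $r_v(u)=u-\frac{\beta(u,v)}{Q(v)}v$ with $Q(v)>0$. Every element of $O_+(V)$ is a product of positive reflections; the positive reflection length $l_+(f)$ is the minimal number of positive reflections in such a product. The partial order on $O_+(V)$ is: $g\le f$ iff $l_+(f)=l_+(g)+l_+(g^{-1}f)$, and $[\mathrm{id},f]=\{h\in O_+(V)\mid\mathrm{id}\le h\le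 f\}$. *)

theory Defs
  imports "HOL-Analysis.Analysis" "Jordan_Normal_Form.Determinant"
begin

(* The space R^(n+1) is rendered as (real ^ 'n) * real with n = CARD('n) (so n >= 1 holds
   automatically): the first component carries x_1, ..., x_n, the second one is x_(n+1). *)
type_synonym 'n lorentz = "(real ^ 'n) \<times> real"

definition Q :: "'n::finite lorentz \<Rightarrow> real" where
  "Q x = (\<Sum>i\<in>UNIV. (vec_nth (fst x) i)^2) - (snd x)^2"

definition \<beta> :: "'n::finite lorentz \<Rightarrow> 'n lorentz \<Rightarrow> real" where
  "\<beta> u v = Q (u + v) - Q u - Q v"

definition orthogonal_group :: "('n::finite lorentz \<Rightarrow> 'n lorentz) set" where
  "orthogonal_group = {f. linear f \<and> bij f \<and> (\<forall>u. Q (f u) = Q u)}"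

definition Mov :: "('n::finite lorentz \<Rightarrow> 'n lorentz) \<Rightarrow> 'n lorentz set" where
  "Mov f = range (\<lambda>w. w - f w)"

(* For f in the orthogonal group and u, v in Mov f, the value does not depend on the choice of w:
   two choices differ by a fixed vector of f, and these are \<beta>-orthogonal to Mov f. *)
definition wall_form ::
  "('n::finite lorentz \<Rightarrow> 'n lorentz) \<Rightarrow> 'n lorentz \<Rightarrow> 'n lorentz \<Rightarrow> real" where
  "wall_form f u v = \<beta> (SOME w. u = w - f w) v"

definition is_basis :: "'a::real_vector list \<Rightarrow> 'a set \<Rightarrow> bool" where
  "is_basis bs U \<longleftrightarrow> distinct bs \<and> independent (set bs) \<and> span (set bs) = U"

(* Determinant of the Wall form restricted to a subspace U of Mov f, with respect to some
   basis of U.  A change of basis multiplies it by a nonzero square, so only its sign is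
   meaningful.  For U = {0} the basis is empty and the determinant is 1. *)
definition wall_det :: "('n::finite lorentz \<Rightarrow> 'n lorentz) \<Rightarrow> 'n lorentz set \<Rightarrow> real" where
  "wall_det f U =
     (let bs = (SOME bs. is_basis bs U); k = length bs
      in Determinant.det (Matrix.mat k k (\<lambda>(i, j). wall_form f (bs ! i) (bs ! j))))"

definition O_plus :: "('n::finite lorentz \<Rightarrow> 'n lorentz) set" where
  "O_plus = {f \<in> orthogonal_group. wall_det f (Mov f) > 0}"

definition refl_along :: "'n::finite lorentz \<Rightarrow> 'n lorentz \<Rightarrow> 'n lorentz" where
  "refl_along v u = u - (\<beta> u v / Q v) *\<^sub>R v"

definition positive_reflections :: "('n::finite lorentz \<Rightarrow> 'n lorentz) set" where
  "positive_reflections = {refl_along v | v. Q v > 0}"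

(* Only meaningful on O_plus, every element of which is a product of positive reflections. *)
definition l_plus :: "('n::finite lorentz \<Rightarrow> 'n lorentz) \<Rightarrow> nat" where
  "l_plus f = (LEAST k. \<exists>rs. length rs = k \<and> set rs \<subseteq> positive_reflections \<and> f = foldr (\<circ>) rs id)"

definition le_plus ::
  "('n::finite lorentz \<Rightarrow> 'n lorentz) \<Rightarrow> ('n lorentz \<Rightarrow> 'n lorentz) \<Rightarrow> bool" where
  "le_plus g f \<longleftrightarrow> l_plus f = l_plus g + l_plus (inv_into UNIV g \<circ> f)"

definition interval_id ::
  "('n::finite lorentz \<Rightarrow> 'n lorentz) \<Rightarrow> ('n lorentz \<Rightarrow> 'n lorentz) set" where
  "interval_id f = {h \<in> O_plus. le_plus id h \<and> le_plus h f}"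

definition poset_isomorphic ::
  "'a set \<Rightarrow> ('a \<Rightarrow> 'a \<Rightarrow> bool) \<Rightarrow> 'b set \<Rightarrow> ('b \<Rightarrow> 'b \<Rightarrow> bool) \<Rightarrow> bool" where
  "poset_isomorphic A leA B leB \<longleftrightarrow>
     (\<exists>\<phi>. bij_betw \<phi> A B \<and> (\<forall>x\<in>A. \<forall>y\<in>A. leA x y \<longleftrightarrow> leB (\<phi> x) (\<phi> y)))"

end

(* If f = g h with Mov(g) and Mov(h) meeting only in 0, then Mov(f) is their direct sum and the
   Wall form of f is block triangular: it restricts to those of g and h, and pairs Mov(g) with
   Mov(h) to 0. Hence Wall determinants multiply up to squares. In signature (n,1) a negative
   semidefinite subspace is at most a line, so a positive f other than the identity moves some v
   with Q(v) > 0; splitting off the reflection along v lowers dim Mov(f) by one and keeps f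
   positive. Therefore l_plus f = dim Mov(f), and g <= f means that g and g^-1 f split f in the
   above sense, i.e. that Mov(g) is contained in Mov(f) with the restricted Wall form. Since an
   isometry is determined by its moved space and Wall form, and each non-degenerate subspace of
   Mov(f) is realised, the isomorphism is g |-> Mov(g). *)

theory Submission
  imports Defs
begin

section \<open>Gram determinants\<close>

text \<open>Indexed by a list, as in \<open>wall_det\<close>, so that joining two bases yields a
  block matrix.\<close>

definition gram :: "('a \<Rightarrow> 'a \<Rightarrow> real) \<Rightarrow> 'a list \<Rightarrow> real Matrix.mat" where
  "gram B bs = Matrix.mat (length bs) (length bs) (\<lambda>(i, j). B (bs ! i) (bs ! j))"

lemma gram_carrier [simp]: "gram B bs \<in> carrier_mat (length bs) (length bs)"
  by (simp add: gram_def)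

lemma gram_index [simp]:
  "i < length bs \<Longrightarrow> j < length bs \<Longrightarrow> gram B bs $$ (i, j) = B (bs ! i) (bs ! j)"
  by (simp add: gram_def)

lemma gram_dim [simp]: "dim_row (gram B bs) = length bs" "dim_col (gram B bs) = length bs"
  by (simp_all add: gram_def)

lemma gram_flip: "gram (\<lambda>x y. B y x) bs = transpose_mat (gram B bs)"
  by (intro eq_matI) auto

lemma gram_cong:
  assumes "\<And>x y. x \<in> set bs \<Longrightarrow> y \<in> set bs \<Longrightarrow> B x y = C x y"
  shows "gram B bs = gram C bs"
  by (intro eq_matI) (auto simp: assms)

lemma span_list_coords:
  fixes x :: "'a::real_vector"
  assumes "x \<in> span (set bs)"
  shows "\<exists>c. x = (\<Sum>i<length bs. c i *\<^sub>R bs ! i)"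
  using assms
proof (induction bs arbitrary: x)
  case (Cons b bs)
  then obtain k where "x - k *\<^sub>R b \<in> span (set bs)"
    by (auto simp: span_insert)
  then obtain c where "x - k *\<^sub>R b = (\<Sum>i<length bs. c i *\<^sub>R bs ! i)"
    using Cons.IH by blast
  \<comment> \<open>\<open>case_nat k c\<close> puts the coefficient of the head in front of those
    of the tail.\<close>
  then have "x = (\<Sum>i<length (b # bs). case_nat k c i *\<^sub>R (b # bs) ! i)"
    by (simp add: sum.lessThan_Suc_shift algebra_simps del: sum.lessThan_Suc)
  then show ?case by blast
qed simp

lemma bilinear_coords:
  assumes "bilinear B"
  shows "B (\<Sum>i<m. c i *\<^sub>R x i) (\<Sum>j<n. d j *\<^sub>R y j)
       = (\<Sum>i<m. \<Sum>j<n. c i * B (x i) (y j) * d j)"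
  unfolding bilinear_sum[OF assms] sum.cartesian_product
  by (intro sum.cong refl)
     (auto simp: bilinear_lmul[OF assms] bilinear_rmul[OF assms] mult_ac)

text \<open>If the rows of \<open>P\<close> hold the coordinates of \<open>cs\<close> in terms of
  \<open>bs\<close>, the new Gram matrix is \<open>P\<close> times the old one times the transpose
  of \<open>P\<close>, so \<open>r\<close> is the determinant of \<open>P\<close>.\<close>

lemma det_gram_change_of_basis:
  assumes B: "bilinear B" and len: "length cs = length bs" and cs: "set cs \<subseteq> span (set bs)"
  obtains r where "Determinant.det (gram B cs) = r\<^sup>2 * Determinant.det (gram B bs)"
proof -
  let ?n = "length bs"
  have "\<forall>j. \<exists>c. j < ?n \<longrightarrow> cs ! j = (\<Sum>i<?n. c i *\<^sub>R bs ! i)"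
    using span_list_coords cs len by (metis nth_mem subsetD)
  then obtain C where C: "\<And>j. j < ?n \<Longrightarrow> cs ! j = (\<Sum>i<?n. C j i *\<^sub>R bs ! i)"
    by metis
  define P where "P = Matrix.mat ?n ?n (\<lambda>(j, i). C j i)"
  have P [simp]: "P \<in> carrier_mat ?n ?n" "dim_row P = ?n" "dim_col P = ?n"
    by (simp_all add: P_def)
  have "gram B cs = P * (gram B bs * transpose_mat P)"
  proof (rule eq_matI)
    fix j k
    assume "j < dim_row (P * (gram B bs * transpose_mat P))"
      and "k < dim_col (P * (gram B bs * transpose_mat P))"
    then have jk: "j < ?n" "k < ?n" by auto
    then have "gram B cs $$ (j, k) = (\<Sum>i<?n. \<Sum>l<?n. C j i * B (bs ! i) (bs ! l) * C k l)"
      using C[of j] C[of k] len by (simp add: bilinear_coords[OF B])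
    also have "\<dots> = (P * (gram B bs * transpose_mat P)) $$ (j, k)"
      using jk by (simp add: scalar_prod_def P_def sum_distrib_left mult.assoc atLeast0LessThan)
    finally show "gram B cs $$ (j, k) = (P * (gram B bs * transpose_mat P)) $$ (j, k)" .
  qed (simp_all add: len)
  then have "Determinant.det (gram B cs)
      = Determinant.det P * (Determinant.det (gram B bs) * Determinant.det P)"
    by (simp add: det_mult[OF P(1)] det_mult[OF gram_carrier] det_transpose[OF P(1)]
        mult_carrier_mat[OF gram_carrier])
  then show thesis
    by (intro that[of "Determinant.det P"]) (simp add: power2_eq_square)
qed

text \<open>Each determinant is the other one times a square, so positivity passes both
  ways.\<close>

lemma det_gram_pos_basis_indep:
  assumes B: "bilinear B" and len: "length cs = length bs"
    and span: "span (set cs) = span (set bs)"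
  shows "Determinant.det (gram B cs) > 0 \<longleftrightarrow> Determinant.det (gram B bs) > 0"
proof -
  have "set cs \<subseteq> span (set bs)" "set bs \<subseteq> span (set cs)"
    using span span_superset by blast+
  then obtain r s where "Determinant.det (gram B cs) = r\<^sup>2 * Determinant.det (gram B bs)"
    and "Determinant.det (gram B bs) = s\<^sup>2 * Determinant.det (gram B cs)"
    using det_gram_change_of_basis[OF B len] det_gram_change_of_basis[OF B len[symmetric]]
    by metis
  then show ?thesis
    using zero_le_power2[of r] zero_le_power2[of s]
    by (auto simp: zero_less_mult_iff)
qed

text \<open>The form need not be symmetric: one vanishing off-diagonal block makes the matrix block
  triangular.\<close>

lemma det_gram_append:
  assumes "\<And>x y. x \<in> set bs \<Longrightarrow> y \<in> set cs \<Longrightarrow> B x y = 0"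
  shows "Determinant.det (gram B (bs @ cs))
       = Determinant.det (gram B bs) * Determinant.det (gram B cs)"
proof -
  let ?L = "Matrix.mat (length cs) (length bs) (\<lambda>(i, j). B (cs ! i) (bs ! j))"
  have "gram B (bs @ cs)
      = four_block_mat (gram B bs) (0\<^sub>m (length bs) (length cs)) ?L (gram B cs)"
    by (rule eq_matI) (auto simp: nth_append assms)
  also have "Determinant.det \<dots>
      = Determinant.det (gram B bs) * Determinant.det (gram B cs)"
    by (rule det_four_block_mat_upper_right_zero[OF gram_carrier refl _ gram_carrier]) simp
  finally show ?thesis .
qed

text \<open>The coordinates of such a \<open>v\<close> form a vector in the kernel of an invertible
  Gram matrix.\<close>

lemma det_gram_nonzero_right_nondegenerate:
  assumes B: "bilinear B" and det: "Determinant.det (gram B bs) \<noteq> 0"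
    and v: "v \<in> span (set bs)" and zero: "\<And>u. u \<in> span (set bs) \<Longrightarrow> B u v = 0"
  shows "v = 0"
proof -
  let ?n = "length bs"
  obtain c where c: "v = (\<Sum>i<?n. c i *\<^sub>R bs ! i)"
    using span_list_coords[OF v] by blast
  define x where "x = Matrix.vec ?n c"
  have "vec_index (gram B bs *\<^sub>v x) i = 0" if i: "i < ?n" for i
  proof -
    have "vec_index (gram B bs *\<^sub>v x) i = (\<Sum>j<?n. c j * B (bs ! i) (bs ! j))"
      using i by (simp add: x_def scalar_prod_def atLeast0LessThan mult.commute)
    also have "\<dots> = B (bs ! i) v"
    proof -
      interpret linear "B (bs ! i)" using B by (simp add: bilinear_def)
      show ?thesis unfolding c by (simp add: sum scaleR)
    qed
    finally show ?thesis using zero i by (simp add: span_base)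
  qed
  then have "gram B bs *\<^sub>v x = 0\<^sub>v ?n" by (intro eq_vecI) auto
  moreover have "x \<in> carrier_vec ?n" by (simp add: x_def)
  ultimately have "x = 0\<^sub>v ?n"
    using det det_0_iff_vec_prod_zero_field[OF gram_carrier] by blast
  then have "c i = 0" if "i < ?n" for i
    using that by (metis x_def index_vec index_zero_vec(1))
  then show ?thesis by (simp add: c)
qed

lemma det_gram_nonzero_left_nondegenerate:
  assumes B: "bilinear B" and det: "Determinant.det (gram B bs) \<noteq> 0"
    and u: "u \<in> span (set bs)" and zero: "\<And>v. v \<in> span (set bs) \<Longrightarrow> B u v = 0"
  shows "u = 0"
proof (rule det_gram_nonzero_right_nondegenerate[where B = "\<lambda>x y. B y x"])
  show "bilinear (\<lambda>x y. B y x)" using B by (simp add: bilinear_def)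
  show "Determinant.det (gram (\<lambda>x y. B y x) bs) \<noteq> 0"
    using det unfolding gram_flip[of B] by (simp add: det_transpose[OF gram_carrier])
qed (fact u, fact zero)

section \<open>The Wall form\<close>

lemma Q_eq: "Q x = inner (fst x) (fst x) - (snd x)\<^sup>2"
  by (simp add: Q_def inner_vec_def power2_eq_square)

lemma beta_eq: "\<beta> u v = 2 * (inner (fst u) (fst v) - snd u * snd v)"
  by (simp add: \<beta>_def Q_eq inner_add_left inner_add_right inner_commute power2_eq_square
      algebra_simps)

lemma bilinear_beta: "bilinear \<beta>"
  by (auto simp: bilinear_def beta_eq inner_add_left inner_add_right algebra_simps
      intro!: linearI)

lemma beta_sym: "\<beta> u v = \<beta> v u"
  by (simp add: beta_eq inner_commute mult.commute)

lemma beta_self: "\<beta> u u = 2 * Q u"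
  by (simp add: beta_eq Q_eq power2_eq_square)

lemmas beta_simps =
  bilinear_ladd[OF bilinear_beta] bilinear_radd[OF bilinear_beta]
  bilinear_lsub[OF bilinear_beta] bilinear_rsub[OF bilinear_beta]
  bilinear_lmul[OF bilinear_beta] bilinear_rmul[OF bilinear_beta]
  bilinear_lzero[OF bilinear_beta] bilinear_rzero[OF bilinear_beta]

text \<open>Changing the sign of the last coordinate turns \<beta> into twice the Euclidean inner
  product, which gives access to Euclidean orthogonality.\<close>

lemma beta_conj: "\<beta> (fst x, - snd x) v = 2 * inner x v"
  by (simp add: beta_eq inner_prod_def)

lemma beta_nondegenerate:
  assumes "\<And>v. \<beta> u v = 0"
  shows "u = 0"
proof -
  have "2 * inner u u = \<beta> u (fst u, - snd u)"
    by (subst beta_sym) (simp only: beta_conj)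
  then show ?thesis using assms by simp
qed

lemma Q_diff: "Q (x - u) = Q x - \<beta> x u + Q u"
proof -
  have "2 * Q (x - u) = 2 * (Q x - \<beta> x u + Q u)"
    unfolding distrib_left right_diff_distrib beta_self[symmetric]
    by (simp add: beta_simps beta_sym[of u x])
  then show ?thesis by simp
qed

lemma Q_scale: "Q (c *\<^sub>R x) = c\<^sup>2 * Q x"
  by (simp add: Q_eq power2_eq_square algebra_simps)

text \<open>A subspace is its own double complement for \<beta>. Split \<open>x\<close> as
  \<open>y + z\<close> with \<open>y\<close> in \<open>A\<close> and \<open>z\<close>
  Euclidean-orthogonal to \<open>A\<close>; the conjugate of \<open>z\<close> is \<beta>-orthogonal
  to \<open>A\<close>, hence to \<open>x\<close>, and this forces \<open>z = 0\<close>.\<close>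

lemma double_perp:
  fixes A :: "'n::finite lorentz set"
  assumes A: "subspace A"
    and x: "\<And>z. (\<And>a. a \<in> A \<Longrightarrow> \<beta> z a = 0) \<Longrightarrow> \<beta> z x = 0"
  shows "x \<in> A"
proof -
  obtain y z where y: "y \<in> span A" and z: "\<And>w. w \<in> span A \<Longrightarrow> inner z w = 0"
    and xyz: "x = y + z"
    using orthogonal_subspace_decomp_exists[unfolded Linear_Algebra.orthogonal_def] by blast
  have "\<beta> (fst z, - snd z) a = 0" if "a \<in> A" for a
    using z that by (simp add: beta_conj span_base)
  then have "inner z x = 0"
    using x[of "(fst z, - snd z)"] by (simp add: beta_conj)
  moreover have "inner z y = 0"
    using z y by simp
  ultimately have "z = 0"
    by (simp add: xyz inner_add_right)
  then show ?thesis
    using y xyz span_minimal[OF subset_refl A] by auto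
qed

section \<open>Isometries\<close>

lemma orthogonal_groupD:
  assumes "f \<in> orthogonal_group"
  shows "linear f" "bij f" "Q (f u) = Q u" "\<beta> (f u) (f v) = \<beta> u v"
proof -
  show f: "linear f" "bij f" "Q (f u) = Q u" for u
    using assms unfolding orthogonal_group_def by blast+
  show "\<beta> (f u) (f v) = \<beta> u v"
    unfolding \<beta>_def linear_add[OF f(1), symmetric] f(3) ..
qed

text \<open>Bijectivity is automatic: preserving a nondegenerate form makes the kernel trivial, and
  the dimension is finite.\<close>

lemma orthogonal_groupI:
  fixes f :: "'n::finite lorentz \<Rightarrow> 'n lorentz"
  assumes f: "linear f" and Q: "\<And>u. Q (f u) = Q u"
  shows "f \<in> orthogonal_group"
proof -
  have beta: "\<beta> (f u) (f v) = \<beta> u v" for u v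
    unfolding \<beta>_def linear_add[OF f, symmetric] Q ..
  have "inj f"
  proof (rule linear_injective_0[THEN iffD2, OF f], intro allI impI)
    fix u assume "f u = 0"
    then have "\<beta> u v = 0" for v
      using beta[of u v] by (simp add: beta_simps)
    then show "u = 0" by (rule beta_nondegenerate)
  qed
  then have "bij f"
    using linear_injective_imp_surjective[OF f] by (simp add: bij_def)
  then show ?thesis using f Q by (simp add: orthogonal_group_def)
qed

lemma orthogonal_group_id: "id \<in> orthogonal_group"
  by (simp add: orthogonal_group_def linear_id)

lemma orthogonal_group_comp:
  "g \<in> orthogonal_group \<Longrightarrow> h \<in> orthogonal_group \<Longrightarrow> g \<circ> h \<in> orthogonal_group"
  by (simp add: orthogonal_group_def linear_compose bij_comp del: split_paired_All)

lemma orthogonal_group_inv: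
  fixes f :: "'n::finite lorentz \<Rightarrow> 'n lorentz"
  assumes "f \<in> orthogonal_group"
  shows "inv_into UNIV f \<in> orthogonal_group"
proof (rule orthogonal_groupI)
  note f = orthogonal_groupD[OF assms]
  show "linear (inv_into UNIV f)"
    using f(1,2) by (simp add: bij_is_inj bij_is_surj linear_linear linear_surj_right_inverse
        inj_linear_imp_inv_linear)
  show "Q (inv_into UNIV f u) = Q u" for u
    using f(3)[of "inv_into UNIV f u"] f(2) by (simp add: bij_is_surj surj_f_inv_f)
qed

section \<open>Moved spaces and the Wall form on them\<close>

lemma subspace_Mov: "f \<in> orthogonal_group \<Longrightarrow> subspace (Mov f)"
  unfolding Mov_def
  by (intro linear_subspace_image linear_compose_sub linear_ident orthogonal_groupD subspace_UNIV)

lemma MovI: "w - f w \<in> Mov f"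
  by (auto simp: Mov_def)

lemma MovE:
  assumes "u \<in> Mov f"
  obtains w where "u = w - f w"
  using assms by (auto simp: Mov_def)

lemma Mov_id: "Mov id = {0}"
  by (auto simp: Mov_def)

text \<open>Invariance of \<beta> gives
  \<open>\<beta> (f w - w) (f x) = \<beta> w (x - f x)\<close>, and \<open>f x\<close> runs through
  the whole space.\<close>

lemma fixed_iff_perp_Mov:
  assumes "f \<in> orthogonal_group"
  shows "f w = w \<longleftrightarrow> (\<forall>v\<in>Mov f. \<beta> w v = 0)"
proof
  note f = orthogonal_groupD[OF assms]
  show "\<forall>v\<in>Mov f. \<beta> w v = 0" if "f w = w"
  proof
    fix v assume "v \<in> Mov f"
    then obtain x where "v = x - f x" by (rule MovE)
    then show "\<beta> w v = 0"
      using f(4)[of w x] that by (simp add: beta_simps)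
  qed
  assume perp: "\<forall>v\<in>Mov f. \<beta> w v = 0"
  have "\<beta> (f w - w) v = 0" for v
  proof -
    obtain x where "v = f x" using f(2) by (meson bij_pointE)
    then show ?thesis
      using perp[rule_format, OF MovI[of x f]] f(4)[of w x] by (simp add: beta_simps)
  qed
  then show "f w = w"
    using beta_nondegenerate[of "f w - w"] by simp
qed

text \<open>Two preimages of \<open>u\<close> under \<open>id - f\<close> differ by a fixed vector,
  which is orthogonal to \<open>Mov f\<close>; so the chosen preimage may be replaced by any
  other.\<close>

lemma wall_form_eq:
  assumes f: "f \<in> orthogonal_group" and u: "u = w - f w" and v: "v \<in> Mov f"
  shows "wall_form f u v = \<beta> w v"
proof -
  define w' where "w' = (SOME w. u = w - f w)"
  have "u = w' - f w'"
    unfolding w'_def using u by (rule someI)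
  then have "f (w - w') = w - w'"
    using u by (simp add: linear_diff[OF orthogonal_groupD(1)[OF f]] algebra_simps)
  then have "\<beta> (w - w') v = 0"
    using fixed_iff_perp_Mov[OF f] v by blast
  then show ?thesis
    by (simp add: wall_form_def w'_def[symmetric] beta_simps)
qed

text \<open>Expanding \<open>Q (w - u) = Q w\<close> leaves
  \<open>\<beta> w u = Q u\<close>.\<close>

lemma wall_form_self:
  assumes f: "f \<in> orthogonal_group" and u: "u \<in> Mov f"
  shows "wall_form f u u = Q u"
proof -
  obtain w where w: "u = w - f w" using u by (rule MovE)
  then have "f w = w - u" by simp
  then have "Q (w - u) = Q w" using orthogonal_groupD(3)[OF f, of w] by simp
  then show ?thesis using wall_form_eq[OF f w u] by (simp add: Q_diff)
qed

lemma wall_form_nondegenerate: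
  assumes f: "f \<in> orthogonal_group" and u: "u \<in> Mov f"
    and zero: "\<And>v. v \<in> Mov f \<Longrightarrow> wall_form f u v = 0"
  shows "u = 0"
proof -
  obtain w where w: "u = w - f w" using u by (rule MovE)
  then have "f w = w"
    using fixed_iff_perp_Mov[OF f] wall_form_eq[OF f w] zero by simp
  with w show ?thesis by simp
qed

text \<open>Off \<open>Mov f\<close> nothing is known about \<open>wall_form\<close>, whereas the
  Gram matrix lemmas ask for a form that is bilinear everywhere. A linear right inverse
  \<open>s\<close> of \<open>id - f\<close> on \<open>Mov f\<close> supplies one.\<close>

lemma wall_form_bilinear_extension:
  assumes f: "f \<in> orthogonal_group"
  obtains B where "bilinear B"
    "\<And>u v. u \<in> Mov f \<Longrightarrow> v \<in> Mov f \<Longrightarrow> wall_form f u v = B u v"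
proof -
  let ?D = "\<lambda>w. w - f w"
  have "linear ?D"
    by (intro linear_compose_sub linear_ident orthogonal_groupD f)
  then obtain s where s: "linear s" "\<And>u. u \<in> Mov f \<Longrightarrow> s u - f (s u) = u"
    using linear_exists_right_inverse_on[OF _ subspace_UNIV, of ?D]
    unfolding Mov_def by blast
  show thesis
  proof
    show "bilinear (\<lambda>u v. \<beta> (s u) v)"
      unfolding bilinear_def
      by (intro conjI allI linearI)
         (simp_all only: linear_add[OF s(1)] linear_scale[OF s(1)] beta_simps)
    show "wall_form f u v = \<beta> (s u) v" if "u \<in> Mov f" "v \<in> Mov f" for u v
      using wall_form_eq[OF f _ that(2), of u "s u"] s(2)[OF that(1)] by simp
  qed
qed

text \<open>This is the polarization of \<open>wall_form_self\<close>.\<close>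

lemma wall_form_add_transpose:
  assumes f: "f \<in> orthogonal_group" and u: "u \<in> Mov f" and v: "v \<in> Mov f"
  shows "wall_form f u v + wall_form f v u = \<beta> u v"
proof -
  obtain B where B: "bilinear B"
    and eq: "\<And>u v. u \<in> Mov f \<Longrightarrow> v \<in> Mov f \<Longrightarrow> wall_form f u v = B u v"
    using wall_form_bilinear_extension[OF f] by blast
  have "u + v \<in> Mov f" using subspace_add[OF subspace_Mov[OF f] u v] .
  then have "Q u = B u u" "Q v = B v v" "Q (u + v) = B (u + v) (u + v)"
    using u v eq wall_form_self[OF f] by metis+
  then show ?thesis
    using u v by (simp add: \<beta>_def eq bilinear_ladd[OF B] bilinear_radd[OF B])
qed

section \<open>Bases and the sign of the Wall determinant\<close>

lemma basis_list_exists: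
  fixes U :: "'a::euclidean_space set"
  assumes "subspace U"
  shows "\<exists>bs. is_basis bs U"
  using basis_subspace_exists[OF assms] finite_distinct_list
  by (metis is_basis_def)

lemma length_basis:
  assumes "is_basis bs U"
  shows "length bs = dim U"
  using assms by (metis dim_span dim_eq_card_independent distinct_card is_basis_def)

text \<open>Trades the basis hidden in \<open>wall_det\<close> for a convenient one; a spanning list
  of length \<open>dim U\<close> is a basis.\<close>

lemma wall_det_pos_iff:
  assumes f: "f \<in> orthogonal_group" and U: "subspace U" "U \<subseteq> Mov f"
    and bs: "span (set bs) = U" "length bs = dim U"
  shows "wall_det f U > 0 \<longleftrightarrow> Determinant.det (gram (wall_form f) bs) > 0"
proof -
  obtain B where B: "bilinear B"
    and eq: "\<And>u v. u \<in> Mov f \<Longrightarrow> v \<in> Mov f \<Longrightarrow> wall_form f u v = B u v"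
    using wall_form_bilinear_extension[OF f] by blast
  define cs where "cs = (SOME bs. is_basis bs U)"
  have cs: "is_basis cs U"
    unfolding cs_def using basis_list_exists[OF U(1)] by (rule someI_ex)
  then have span: "span (set cs) = U" by (simp add: is_basis_def)
  have "gram (wall_form f) xs = gram B xs" if "span (set xs) = U" for xs
    using that U(2) span_superset[of "set xs"] by (intro gram_cong eq) auto
  then have "gram (wall_form f) bs = gram B bs" "gram (wall_form f) cs = gram B cs"
    using bs(1) span by simp_all
  moreover have "wall_det f U = Determinant.det (gram (wall_form f) cs)"
    by (simp add: wall_det_def cs_def gram_def Let_def)
  ultimately show ?thesis
    using det_gram_pos_basis_indep[OF B, of cs bs] length_basis[OF cs] bs span by simp
qed

text \<open>As \<open>w - f w\<close> runs through \<open>Mov f\<close>, the vector \<open>w\<close>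
  runs through the whole space, so \<open>v\<close> is \<beta>-orthogonal to everything.\<close>

lemma wall_form_right_nondegenerate:
  assumes f: "f \<in> orthogonal_group" and v: "v \<in> Mov f"
    and zero: "\<And>u. u \<in> Mov f \<Longrightarrow> wall_form f u v = 0"
  shows "v = 0"
proof (rule beta_nondegenerate)
  show "\<beta> v w = 0" for w
    using wall_form_eq[OF f refl v, of w] zero[OF MovI] by (simp add: beta_sym)
qed

text \<open>The basis chosen in \<open>wall_det\<close> depends on \<open>U\<close> alone, so the
  determinants agree exactly and not just in sign.\<close>

lemma wall_det_cong:
  assumes U: "subspace U" and eq: "\<And>u v. u \<in> U \<Longrightarrow> v \<in> U \<Longrightarrow> wall_form g u v = wall_form f u v"
  shows "wall_det g U = wall_det f U"
proof -
  define bs where "bs = (SOME bs. is_basis bs U)"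
  have "is_basis bs U"
    unfolding bs_def using basis_list_exists[OF U] by (rule someI_ex)
  then have "set bs \<subseteq> U"
    using span_superset by (auto simp: is_basis_def)
  then have "gram (wall_form g) bs = gram (wall_form f) bs"
    by (intro gram_cong eq) auto
  then show ?thesis
    by (simp add: wall_det_def bs_def gram_def Let_def)
qed

section \<open>Direct factorizations\<close>

lemma Mov_comp_subset: "Mov (g \<circ> h) \<subseteq> {x + y |x y. x \<in> Mov g \<and> y \<in> Mov h}"
proof
  fix u assume "u \<in> Mov (g \<circ> h)"
  then obtain w where "u = w - (g \<circ> h) w" by (rule MovE)
  then have "u = (h w - g (h w)) + (w - h w)" by simp
  then show "u \<in> {x + y |x y. x \<in> Mov g \<and> y \<in> Mov h}"
    using MovI by blast
qed

text \<open>The intersection term is kept so that additivity of dimensions forces the moved spaces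
  to meet trivially.\<close>

lemma dim_Mov_comp_le:
  assumes g: "g \<in> orthogonal_group" and h: "h \<in> orthogonal_group"
  shows "dim (Mov (g \<circ> h)) + dim (Mov g \<inter> Mov h) \<le> dim (Mov g) + dim (Mov h)"
  using dim_subset[OF Mov_comp_subset[of g h]]
    dim_sums_Int[OF subspace_Mov[OF g] subspace_Mov[OF h]] by linarith

context
  fixes g h :: "'n::finite lorentz \<Rightarrow> 'n lorentz"
  assumes g: "g \<in> orthogonal_group" and h: "h \<in> orthogonal_group"
    and Int: "Mov g \<inter> Mov h \<subseteq> {0}"
begin

text \<open>A vector has at most one decomposition along the two independent moved spaces.\<close>

lemma Mov_comp_split:
  assumes "w - g (h w) = u + v" "u \<in> Mov g" "v \<in> Mov h"
  shows "h w - g (h w) = u" "w - h w = v"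
proof -
  have "(h w - g (h w)) - u = v - (w - h w)"
    using assms(1) by (simp add: algebra_simps)
  moreover have "(h w - g (h w)) - u \<in> Mov g" "v - (w - h w) \<in> Mov h"
    by (intro subspace_diff subspace_Mov g h assms MovI)+
  ultimately have "(h w - g (h w)) - u = 0" "v - (w - h w) = 0"
    using Int by (metis IntI singletonD subsetD)+
  then show "h w - g (h w) = u" "w - h w = v" by (metis right_minus_eq)+
qed

text \<open>By double complements it suffices to compare fixed vectors. If
  \<open>g \<circ> h\<close> fixes \<open>z\<close>, splitting \<open>0 = z - g (h z)\<close> shows
  that \<open>h\<close> and \<open>g\<close> both fix \<open>z\<close>.\<close>

lemma Mov_subset_Mov_comp: "Mov g \<subseteq> Mov (g \<circ> h)" "Mov h \<subseteq> Mov (g \<circ> h)"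
proof -
  note gh = orthogonal_group_comp[OF g h]
  have fixed: "g z = z \<and> h z = z" if "\<And>a. a \<in> Mov (g \<circ> h) \<Longrightarrow> \<beta> z a = 0" for z
  proof -
    have "g (h z) = z" using fixed_iff_perp_Mov[OF gh, of z] that by simp
    then show ?thesis
      using Mov_comp_split[of z 0 0] subspace_0[OF subspace_Mov[OF g]]
        subspace_0[OF subspace_Mov[OF h]] by simp
  qed
  show "Mov g \<subseteq> Mov (g \<circ> h)"
  proof
    fix x assume "x \<in> Mov g"
    then show "x \<in> Mov (g \<circ> h)"
      by (intro double_perp[OF subspace_Mov[OF gh]]) (metis fixed fixed_iff_perp_Mov[OF g])
  qed
  show "Mov h \<subseteq> Mov (g \<circ> h)"
  proof
    fix x assume "x \<in> Mov h"
    then show "x \<in> Mov (g \<circ> h)"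
      by (intro double_perp[OF subspace_Mov[OF gh]]) (metis fixed fixed_iff_perp_Mov[OF h])
  qed
qed

lemma Mov_comp_eq: "Mov (g \<circ> h) = {x + y |x y. x \<in> Mov g \<and> y \<in> Mov h}"
proof
  show "{x + y |x y. x \<in> Mov g \<and> y \<in> Mov h} \<subseteq> Mov (g \<circ> h)"
    using Mov_subset_Mov_comp subspace_add[OF subspace_Mov[OF orthogonal_group_comp[OF g h]]]
    by blast
qed (rule Mov_comp_subset)

lemma dim_Mov_comp: "dim (Mov (g \<circ> h)) = dim (Mov g) + dim (Mov h)"
proof -
  have "dim (Mov g \<inter> Mov h) = 0" using Int by (simp only: dim_eq_0)
  then show ?thesis
    using dim_sums_Int[OF subspace_Mov[OF g] subspace_Mov[OF h]]
    unfolding Mov_comp_eq by linarith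
qed

text \<open>A preimage of \<open>u\<close> under \<open>id - g \<circ> h\<close> is fixed by
  \<open>h\<close>. Hence it is also a preimage under \<open>id - g\<close>, and it is orthogonal to
  \<open>Mov h\<close>.\<close>

lemma wall_form_comp_left:
  assumes u: "u \<in> Mov g" and v: "v \<in> Mov g"
  shows "wall_form (g \<circ> h) u v = wall_form g u v"
    and "y \<in> Mov h \<Longrightarrow> wall_form (g \<circ> h) u y = 0"
proof -
  note gh = orthogonal_group_comp[OF g h]
  obtain w where w: "u = w - (g \<circ> h) w"
    using u Mov_subset_Mov_comp MovE by blast
  then have "h w - g (h w) = u" "w - h w = 0"
    using Mov_comp_split[of w u 0] u subspace_0[OF subspace_Mov[OF h]] by simp_all
  then have hw: "h w = w" "u = w - g w" by simp_all
  show "wall_form (g \<circ> h) u v = wall_form g u v"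
    using wall_form_eq[OF gh w] wall_form_eq[OF g hw(2) v] Mov_subset_Mov_comp(1) v
    by (metis subsetD)
  show "wall_form (g \<circ> h) u y = 0" if "y \<in> Mov h"
    using wall_form_eq[OF gh w] fixed_iff_perp_Mov[OF h] hw(1) Mov_subset_Mov_comp(2) that
    by (metis subsetD)
qed

text \<open>The component in \<open>Mov g\<close> vanishes, so a preimage of \<open>u\<close> under
  \<open>id - g \<circ> h\<close> is also one under \<open>id - h\<close>.\<close>

lemma wall_form_comp_right:
  assumes u: "u \<in> Mov h" and v: "v \<in> Mov h"
  shows "wall_form (g \<circ> h) u v = wall_form h u v"
proof -
  note gh = orthogonal_group_comp[OF g h]
  obtain w where w: "u = w - (g \<circ> h) w"
    using u Mov_subset_Mov_comp MovE by blast
  then have "u = w - h w"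
    using Mov_comp_split[of w 0 u] u subspace_0[OF subspace_Mov[OF g]] by simp
  then show ?thesis
    using wall_form_eq[OF gh w] wall_form_eq[OF h _ v] Mov_subset_Mov_comp(2) v
    by (metis subsetD)
qed

text \<open>In a basis of \<open>Mov g\<close> followed by one of \<open>Mov h\<close> the Gram
  matrix is block triangular, with the Gram matrices of \<open>g\<close> and \<open>h\<close> on the
  diagonal.\<close>

lemma wall_det_comp_pos_iff:
  assumes pos: "wall_det g (Mov g) > 0"
  shows "wall_det (g \<circ> h) (Mov (g \<circ> h)) > 0 \<longleftrightarrow> wall_det h (Mov h) > 0"
proof -
  note gh = orthogonal_group_comp[OF g h]
  obtain bs cs where bs: "is_basis bs (Mov g)" and cs: "is_basis cs (Mov h)"
    using basis_list_exists subspace_Mov g h by meson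
  have span: "span (set bs) = Mov g" "span (set cs) = Mov h"
    using bs cs by (simp_all add: is_basis_def)
  have sub: "set bs \<subseteq> Mov g" "set cs \<subseteq> Mov h"
    using span span_superset by blast+
  have "span (set (bs @ cs)) = Mov (g \<circ> h)"
    by (simp add: span_Un span Mov_comp_eq)
  moreover have "length (bs @ cs) = dim (Mov (g \<circ> h))"
    by (simp add: dim_Mov_comp length_basis[OF bs] length_basis[OF cs])
  ultimately have "wall_det (g \<circ> h) (Mov (g \<circ> h)) > 0
      \<longleftrightarrow> Determinant.det (gram (wall_form (g \<circ> h)) (bs @ cs)) > 0"
    by (intro wall_det_pos_iff gh subspace_Mov subset_refl)
  also have "Determinant.det (gram (wall_form (g \<circ> h)) (bs @ cs))
      = Determinant.det (gram (wall_form (g \<circ> h)) bs)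
        * Determinant.det (gram (wall_form (g \<circ> h)) cs)"
    using sub by (intro det_gram_append wall_form_comp_left(2)) auto
  also have "gram (wall_form (g \<circ> h)) bs = gram (wall_form g) bs"
    using sub by (intro gram_cong wall_form_comp_left(1)) auto
  also have "gram (wall_form (g \<circ> h)) cs = gram (wall_form h) cs"
    using sub by (intro gram_cong wall_form_comp_right) auto
  also have "Determinant.det (gram (wall_form g) bs) * Determinant.det (gram (wall_form h) cs) > 0
      \<longleftrightarrow> Determinant.det (gram (wall_form h) cs) > 0"
    using pos wall_det_pos_iff[OF g subspace_Mov[OF g] subset_refl span(1) length_basis[OF bs]]
    by (simp add: zero_less_mult_iff)
  also have "\<dots> \<longleftrightarrow> wall_det h (Mov h) > 0"
    using wall_det_pos_iff[OF h subspace_Mov[OF h] subset_refl span(2) length_basis[OF cs]]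
    by simp
  finally show ?thesis .
qed

end

text \<open>Converse to the splitting of the Wall form. For \<open>v\<close> in both moved spaces
  and \<open>u\<close> in \<open>Mov g\<close>, the Wall form of \<open>f\<close> at
  \<open>(v, u)\<close> already equals \<open>\<beta> u v\<close>. As it and its transpose add up to
  \<beta>, it vanishes at \<open>(u, v)\<close>, and nondegeneracy for \<open>g\<close> yields
  \<open>v = 0\<close>.\<close>

lemma Mov_Int_complement:
  assumes f: "f \<in> orthogonal_group" and g: "g \<in> orthogonal_group" and h: "h \<in> orthogonal_group"
    and fgh: "f = g \<circ> h" and sub: "Mov g \<subseteq> Mov f"
    and eq: "\<And>u v. u \<in> Mov g \<Longrightarrow> v \<in> Mov g \<Longrightarrow> wall_form g u v = wall_form f u v"
  shows "Mov g \<inter> Mov h \<subseteq> {0}"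
proof
  fix v assume v: "v \<in> Mov g \<inter> Mov h"
  then obtain x where x: "v = x - h x" by (auto elim: MovE)
  define y where "y = h x"
  define a where "a = y - g y"
  have a: "a \<in> Mov g" by (simp add: a_def MovI)
  have v_eq: "v = (x - f x) - a" by (simp add: fgh x a_def y_def)
  obtain B where B: "bilinear B"
    and BE: "\<And>u v. u \<in> Mov f \<Longrightarrow> v \<in> Mov f \<Longrightarrow> wall_form f u v = B u v"
    using wall_form_bilinear_extension[OF f] by blast
  have "wall_form g u v = 0" if u: "u \<in> Mov g" for u
  proof -
    have "wall_form f v u = B (x - f x) u - B a u"
      using v u sub BE v_eq bilinear_lsub[OF B] by (metis IntD1 subsetD)
    also have "\<dots> = wall_form f (x - f x) u - wall_form g a u"
      using u a sub eq BE MovI by (metis subsetD)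
    also have "\<dots> = \<beta> x u - \<beta> y u"
      using u sub wall_form_eq[OF f refl, of u x] wall_form_eq[OF g a_def, of u] by (metis subsetD)
    also have "\<dots> = \<beta> u v"
      by (simp add: x y_def[symmetric] beta_simps beta_sym[of u])
    finally have "wall_form f u v = 0"
      using wall_form_add_transpose[OF f, of u v] u v sub by auto
    then show ?thesis using eq u v by simp
  qed
  then show "v \<in> {0}"
    using wall_form_right_nondegenerate[OF g, of v] v by simp
qed

section \<open>Isometries determined by moved space and Wall form\<close>

lemma orthogonal_group_eqI:
  assumes f: "f \<in> orthogonal_group" and g: "g \<in> orthogonal_group" and Mov: "Mov f = Mov g"
    and eq: "\<And>u v. u \<in> Mov f \<Longrightarrow> v \<in> Mov f \<Longrightarrow> wall_form f u v = wall_form g u v"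
  shows "f = g"
proof
  fix x
  obtain B where B: "bilinear B"
    and BE: "\<And>u v. u \<in> Mov f \<Longrightarrow> v \<in> Mov f \<Longrightarrow> wall_form f u v = B u v"
    using wall_form_bilinear_extension[OF f] by blast
  have mem: "x - f x \<in> Mov f" "x - g x \<in> Mov f" using Mov MovI by metis+
  \<comment> \<open>Both \<open>x - f x\<close> and \<open>x - g x\<close> represent the functional
    \<open>\<beta> x\<close> on \<open>Mov f\<close> through the same nondegenerate form.\<close>
  have "(x - f x) - (x - g x) = 0"
  proof (rule wall_form_nondegenerate[OF f])
    show d: "(x - f x) - (x - g x) \<in> Mov f"
      using mem subspace_diff[OF subspace_Mov[OF f]] by blast
    fix v assume v: "v \<in> Mov f"
    have "wall_form f ((x - f x) - (x - g x)) v = wall_form f (x - f x) v - wall_form f (x - g x) v"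
      using d mem v by (simp only: BE bilinear_lsub[OF B])
    also have "\<dots> = \<beta> x v - \<beta> x v"
      using mem v eq Mov wall_form_eq[OF f refl v, of x] wall_form_eq[OF g refl, of v x] by metis
    finally show "wall_form f ((x - f x) - (x - g x)) v = 0" by simp
  qed
  then show "f x = g x" by simp
qed

text \<open>The isometry has to be \<open>x - T x\<close>, where \<open>T x\<close> in
  \<open>U\<close> represents \<open>\<beta> x\<close> on \<open>U\<close> through the Wall form of
  \<open>f\<close>. The positive determinant makes the restricted form nondegenerate, which yields
  existence and uniqueness of \<open>T x\<close>.\<close>

lemma isometry_with_Mov_exists:
  assumes f: "f \<in> orthogonal_group" and U: "subspace U" "U \<subseteq> Mov f"
    and det: "wall_det f U > 0"
  obtains g where "g \<in> orthogonal_group" "Mov g = U"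
    "\<And>u v. u \<in> U \<Longrightarrow> v \<in> U \<Longrightarrow> wall_form g u v = wall_form f u v"
proof -
  obtain B where B: "bilinear B"
    and BE: "\<And>u v. u \<in> Mov f \<Longrightarrow> v \<in> Mov f \<Longrightarrow> wall_form f u v = B u v"
    using wall_form_bilinear_extension[OF f] by blast
  note B_simps = bilinear_ladd[OF B] bilinear_lsub[OF B] bilinear_lmul[OF B] bilinear_lzero[OF B]
  obtain bs where bs: "is_basis bs U" using basis_list_exists[OF U(1)] by blast
  have span: "span (set bs) = U" using bs by (simp add: is_basis_def)
  have "gram (wall_form f) bs = gram B bs"
    using span U(2) span_superset[of "set bs"] by (intro gram_cong BE) auto
  then have "Determinant.det (gram B bs) \<noteq> 0"
    using wall_det_pos_iff[OF f U span length_basis[OF bs]] det by simp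
  note nondegenerate = det_gram_nonzero_left_nondegenerate[OF B this, unfolded span]
    det_gram_nonzero_right_nondegenerate[OF B this, unfolded span]
  \<comment> \<open>Every functional \<open>\<beta> x\<close> is represented on \<open>U\<close> by some \<open>u\<close>: the vectors \<open>x\<close> for which
    this holds form a subspace that contains the complement of \<open>U\<close> and all preimages of \<open>U\<close>
    under \<open>id - f\<close>, so nothing nonzero is orthogonal to it. The isometry is then \<open>x - u\<close>.\<close>
  define A where "A = {x. \<exists>u\<in>U. \<forall>v\<in>U. B u v = \<beta> x v}"
  have "subspace A"
  proof (rule subspaceI)
    show "0 \<in> A"
      using subspace_0[OF U(1)] by (force simp: A_def B_simps beta_simps)
  next
    fix x y assume "x \<in> A" "y \<in> A"
    then obtain u u' where "u \<in> U" "u' \<in> U"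
      "\<forall>v\<in>U. B u v = \<beta> x v" "\<forall>v\<in>U. B u' v = \<beta> y v" by (auto simp: A_def)
    then show "x + y \<in> A"
      unfolding A_def using subspace_add[OF U(1)]
      by (intro CollectI bexI[of _ "u + u'"]) (simp_all add: B_simps beta_simps)
  next
    fix x and c :: real assume "x \<in> A"
    then obtain u where "u \<in> U" "\<forall>v\<in>U. B u v = \<beta> x v" by (auto simp: A_def)
    then show "c *\<^sub>R x \<in> A"
      unfolding A_def using subspace_scale[OF U(1)]
      by (intro CollectI bexI[of _ "c *\<^sub>R u"]) (simp_all add: B_simps beta_simps)
  qed
  have "x \<in> A" for x
  proof (rule double_perp[OF \<open>subspace A\<close>])
    fix z assume z: "\<And>a. a \<in> A \<Longrightarrow> \<beta> z a = 0"
    have "z \<in> U"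
    proof (rule double_perp[OF U(1)])
      fix y assume "\<And>a. a \<in> U \<Longrightarrow> \<beta> y a = 0"
      then have "y \<in> A"
        using subspace_0[OF U(1)] by (force simp: A_def B_simps)
      then show "\<beta> y z = 0" using z by (simp add: beta_sym)
    qed
    moreover have "B u z = 0" if u: "u \<in> U" for u
    proof -
      obtain w where w: "u = w - f w" using u U(2) MovE by blast
      have Bw: "B u v = \<beta> w v" if "v \<in> U" for v
        using wall_form_eq[OF f w] BE u that U(2) by (metis subsetD)
      then have "w \<in> A" unfolding A_def using u by blast
      then show ?thesis using Bw[OF \<open>z \<in> U\<close>] z by (simp add: beta_sym)
    qed
    ultimately have "z = 0" by (rule nondegenerate(2))
    then show "\<beta> z x = 0" by (simp add: beta_simps)
  qed
  then have "\<forall>x. \<exists>u. u \<in> U \<and> (\<forall>v\<in>U. B u v = \<beta> x v)" unfolding A_def by blast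
  then obtain T where T: "\<And>x. T x \<in> U" "\<And>x v. v \<in> U \<Longrightarrow> B (T x) v = \<beta> x v"
    by metis
  have T_unique: "T x = u" if "u \<in> U" "\<And>v. v \<in> U \<Longrightarrow> B u v = \<beta> x v" for x u
  proof -
    have "T x - u = 0"
      using that T by (intro nondegenerate(1) subspace_diff[OF U(1)]) (simp_all add: B_simps)
    then show ?thesis by simp
  qed
  have linT: "linear T"
  proof (rule linearI)
    show "T (x + y) = T x + T y" for x y
      by (rule T_unique) (simp_all add: T B_simps beta_simps subspace_add[OF U(1)])
    show "T (c *\<^sub>R x) = c *\<^sub>R T x" for c x
      by (rule T_unique) (simp_all add: T B_simps beta_simps subspace_scale[OF U(1)])
  qed
  define g where "g x = x - T x" for x
  have Tg: "x - g x = T x" for x by (simp add: g_def)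
  have g: "g \<in> orthogonal_group"
  proof (rule orthogonal_groupI)
    show "linear g"
      unfolding g_def by (intro linear_compose_sub linear_ident linT)
    \<comment> \<open>Testing the defining property of \<open>T x\<close> on \<open>T x\<close>
      itself makes the two correction terms of \<open>Q (x - T x)\<close> cancel.\<close>
    have "\<beta> x (T x) = Q (T x)" for x
      using T(1)[of x] T(2)[of "T x" x] wall_form_self[OF f, of "T x"] BE[of "T x" "T x"] U(2)
      by (metis subsetD)
    then show "Q (g x) = Q x" for x by (simp add: g_def Q_diff)
  qed
  have Mov: "Mov g = U"
  proof
    show "Mov g \<subseteq> U" using T(1) by (auto simp: Mov_def Tg)
    show "U \<subseteq> Mov g"
    proof
      fix u assume u: "u \<in> U"
      then obtain w where w: "u = w - f w" using U(2) MovE by blast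
      \<comment> \<open>The vector \<open>u\<close> represents \<open>\<beta> w\<close> on
        \<open>U\<close>, so a preimage under \<open>id - f\<close> also serves for
        \<open>id - g\<close>.\<close>
      have "T w = u"
        using u wall_form_eq[OF f w] BE U(2) by (metis T_unique subsetD)
      then show "u \<in> Mov g" using MovI[of w g] by (simp add: Tg)
    qed
  qed
  have "wall_form g u v = wall_form f u v" if uv: "u \<in> U" "v \<in> U" for u v
  proof -
    obtain w where w: "u = w - g w" using uv Mov MovE by blast
    then have "u = T w" by (simp add: Tg)
    then have "wall_form g u v = B u v"
      using wall_form_eq[OF g w] T(2) uv Mov by metis
    then show ?thesis using BE uv U(2) by (metis subsetD)
  qed
  with g Mov show thesis by (rule that)
qed

section \<open>Positive reflections\<close>

lemma O_plusD:
  assumes "f \<in> O_plus"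
  shows "f \<in> orthogonal_group" "wall_det f (Mov f) > 0"
  using assms by (simp_all add: O_plus_def)

lemma O_plus_comp_iff:
  assumes g: "g \<in> O_plus" and h: "h \<in> orthogonal_group" and Int: "Mov g \<inter> Mov h \<subseteq> {0}"
  shows "g \<circ> h \<in> O_plus \<longleftrightarrow> h \<in> O_plus"
  using wall_det_comp_pos_iff[OF O_plusD(1)[OF g] h Int O_plusD(2)[OF g]]
    orthogonal_group_comp[OF O_plusD(1)[OF g] h] h
  by (simp add: O_plus_def)

lemma beta_refl_along:
  assumes "Q v \<noteq> 0"
  shows "\<beta> (refl_along v u) v = - \<beta> u v"
  using assms by (simp add: refl_along_def beta_simps beta_self)

lemma refl_along_involution:
  assumes "Q v \<noteq> 0"
  shows "refl_along v \<circ> refl_along v = id"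
proof
  fix u
  have "refl_along v (refl_along v u)
      = refl_along v u - (\<beta> (refl_along v u) v / Q v) *\<^sub>R v"
    by (simp only: refl_along_def[of v "refl_along v u"])
  also have "\<dots> = u"
    by (simp add: beta_refl_along[OF assms]) (simp add: refl_along_def)
  finally show "(refl_along v \<circ> refl_along v) u = id u" by simp
qed

lemma refl_along_orthogonal:
  assumes "Q v \<noteq> 0"
  shows "refl_along v \<in> orthogonal_group"
proof (rule orthogonal_groupI)
  show "linear (refl_along v)"
    by (rule linearI)
       (simp_all add: refl_along_def beta_simps add_divide_distrib algebra_simps)
  show "Q (refl_along v u) = Q u" for u
    using assms
    by (simp add: refl_along_def Q_diff Q_scale beta_simps power2_eq_square)
qed

lemma Mov_refl_along:
  assumes "Q v \<noteq> 0"
  shows "Mov (refl_along v) = span {v}"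
proof
  have eq: "w - refl_along v w = (\<beta> w v / Q v) *\<^sub>R v" for w
    by (simp add: refl_along_def)
  show "Mov (refl_along v) \<subseteq> span {v}"
  proof
    fix x assume "x \<in> Mov (refl_along v)"
    then obtain w where "x = w - refl_along v w" by (rule MovE)
    then show "x \<in> span {v}" by (simp add: eq span_scale span_base)
  qed
  \<comment> \<open>The reflection negates \<open>v\<close>, so half of \<open>v\<close> is a
    preimage of \<open>v\<close>.\<close>
  have "v = (1/2) *\<^sub>R v - refl_along v ((1/2) *\<^sub>R v)"
    using assms by (simp only: eq) (simp add: beta_simps beta_self)
  then have "v \<in> Mov (refl_along v)" by (metis MovI)
  then show "span {v} \<subseteq> Mov (refl_along v)"
    by (intro span_minimal subspace_Mov refl_along_orthogonal assms) simp
qed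

lemma Q_zero [simp]: "Q 0 = 0"
  by (simp add: Q_eq)

lemma det_gram_Nil: "Determinant.det (gram B []) = 1"
  using gram_carrier[of B "[]"] by simp

lemma det_gram_singleton: "Determinant.det (gram B [v]) = B v v"
  by (subst det_single) (simp_all add: gram_def)

text \<open>The moved space is the line through \<open>v\<close>, where the Wall determinant has the
  sign of \<open>Q v\<close>.\<close>

lemma refl_along_O_plus:
  assumes "Q v > 0"
  shows "refl_along v \<in> O_plus"
proof -
  have Q: "Q v \<noteq> 0" "v \<noteq> 0" using assms by auto
  note r = refl_along_orthogonal[OF Q(1)] and Mov = Mov_refl_along[OF Q(1)]
  have "wall_form (refl_along v) v v = Q v"
    by (rule wall_form_self[OF r]) (simp add: Mov span_base)
  then show ?thesis
    using wall_det_pos_iff[OF r subspace_Mov[OF r] subset_refl, of "[v]"] r assms Q(2)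
    by (simp add: O_plus_def Mov det_gram_singleton)
qed

text \<open>A reflection always enters a direct factorization: of
  \<open>refl_along v \<circ> h\<close> if \<open>v\<close> is outside \<open>Mov h\<close>, and
  otherwise of \<open>h\<close> itself, written as the reflection times
  \<open>refl_along v \<circ> h\<close>.\<close>

lemma Mov_refl_along_Int:
  assumes h: "h \<in> orthogonal_group" and Q: "Q v > 0"
  shows "v \<notin> Mov h \<Longrightarrow> Mov (refl_along v) \<inter> Mov h \<subseteq> {0}"
    and "v \<in> Mov h \<Longrightarrow> Mov (refl_along v) \<inter> Mov (refl_along v \<circ> h) \<subseteq> {0}"
proof -
  have Q0: "Q v \<noteq> 0" using Q by simp
  note r = refl_along_orthogonal[OF Q0] and Mov = Mov_refl_along[OF Q0]
  show "Mov (refl_along v) \<inter> Mov h \<subseteq> {0}" if v: "v \<notin> Mov h"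
  proof
    fix x assume x: "x \<in> Mov (refl_along v) \<inter> Mov h"
    then obtain k where k: "x = k *\<^sub>R v" by (auto simp: Mov span_singleton)
    have "v \<in> Mov h" if "k \<noteq> 0"
      using subspace_scale[OF subspace_Mov[OF h], of x "inverse k"] x k that by simp
    then have "k = 0" using v by blast
    then show "x \<in> {0}" by (simp add: k)
  qed
  show "Mov (refl_along v) \<inter> Mov (refl_along v \<circ> h) \<subseteq> {0}" if v: "v \<in> Mov h"
  proof (rule Mov_Int_complement[OF h r orthogonal_group_comp[OF r h]])
    show "h = refl_along v \<circ> (refl_along v \<circ> h)"
      by (simp add: comp_assoc[symmetric] refl_along_involution[OF Q0])
    show sub: "Mov (refl_along v) \<subseteq> Mov h"
      unfolding Mov using v by (intro span_minimal subspace_Mov h) simp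
    \<comment> \<open>On a line a bilinear form is fixed by one diagonal value, here
      \<open>Q v\<close> for every isometry that has \<open>v\<close> in its moved space.\<close>
    have scale: "wall_form f (a *\<^sub>R v) (b *\<^sub>R v) = a * b * Q v"
      if f: "f \<in> orthogonal_group" and vf: "v \<in> Mov f" for f a b
    proof -
      obtain B where B: "bilinear B"
        and BE: "\<And>u v. u \<in> Mov f \<Longrightarrow> v \<in> Mov f \<Longrightarrow> wall_form f u v = B u v"
        using wall_form_bilinear_extension[OF f] by blast
      have "wall_form f (a *\<^sub>R v) (b *\<^sub>R v) = B (a *\<^sub>R v) (b *\<^sub>R v)"
        by (intro BE subspace_scale subspace_Mov f vf)
      also have "\<dots> = a * b * wall_form f v v"
        by (simp only: bilinear_lmul[OF B] bilinear_rmul[OF B] BE[OF vf vf])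
           (simp add: mult.assoc)
      finally show ?thesis by (simp add: wall_form_self[OF f vf])
    qed
    have "v \<in> Mov (refl_along v)" by (simp add: Mov span_base)
    note scales = scale[OF r this] scale[OF h v]
    show "wall_form (refl_along v) x y = wall_form h x y"
      if xy: "x \<in> Mov (refl_along v)" "y \<in> Mov (refl_along v)" for x y
    proof -
      obtain a b where "x = a *\<^sub>R v" "y = b *\<^sub>R v"
        using xy by (auto simp: Mov span_singleton)
      then show ?thesis by (simp only: scales)
    qed
  qed
qed

text \<open>Of \<open>h\<close> and \<open>refl_along v \<circ> h\<close>, one is the direct product
  of the reflection with the other; the case split decides which.\<close>

lemma refl_along_comp_O_plus_iff:
  assumes h: "h \<in> orthogonal_group" and Q: "Q v > 0"
  shows "refl_along v \<circ> h \<in> O_plus \<longleftrightarrow> h \<in> O_plus"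
proof (cases "v \<in> Mov h")
  case False
  then show ?thesis
    by (intro O_plus_comp_iff refl_along_O_plus Q h Mov_refl_along_Int)
next
  case True
  have Q0: "Q v \<noteq> 0" using Q by simp
  have "refl_along v \<circ> (refl_along v \<circ> h) \<in> O_plus \<longleftrightarrow> refl_along v \<circ> h \<in> O_plus"
    using True
    by (intro O_plus_comp_iff refl_along_O_plus Q orthogonal_group_comp h Mov_refl_along_Int
        refl_along_orthogonal Q0)
  then show ?thesis
    by (simp add: comp_assoc[symmetric] refl_along_involution[OF Q0])
qed

lemma dim_Mov_refl_along_comp:
  assumes h: "h \<in> orthogonal_group" and Q: "Q v > 0" and v: "v \<in> Mov h"
  shows "dim (Mov h) = Suc (dim (Mov (refl_along v \<circ> h)))"
proof -
  have Q0: "Q v \<noteq> 0" "v \<noteq> 0" using Q by auto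
  note r = refl_along_orthogonal[OF Q0(1)]
  have "dim (Mov (refl_along v \<circ> (refl_along v \<circ> h)))
      = dim (Mov (refl_along v)) + dim (Mov (refl_along v \<circ> h))"
    by (intro dim_Mov_comp r orthogonal_group_comp h Mov_refl_along_Int Q v)
  then show ?thesis
    using Q0(2)
    by (simp add: comp_assoc[symmetric] refl_along_involution[OF Q0(1)] Mov_refl_along[OF Q0(1)])
qed

text \<open>A subspace on which \<^term>\<open>Q\<close> is nowhere positive meets the hyperplane of vectors with
  vanishing last coordinate trivially, hence is at most a line; on a line the Wall determinant
  has the sign of \<^term>\<open>Q\<close>.\<close>

lemma positive_vector_exists:
  assumes f: "f \<in> O_plus" and Mov: "Mov f \<noteq> {0}"
  shows "\<exists>v\<in>Mov f. Q v > 0"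
proof (rule ccontr)
  note fO = O_plusD(1)[OF f]
  note sub = subspace_Mov[OF fO]
  assume "\<not> (\<exists>v\<in>Mov f. Q v > 0)"
  then have neg: "Q v \<le> 0" if "v \<in> Mov f" for v
    using that by (meson not_less)
  have hyper: "x = 0" if "x \<in> Mov f" "snd x = 0" for x
  proof -
    have "inner (fst x) (fst x) \<le> 0" using neg[OF that(1)] that(2) by (simp add: Q_eq)
    then have "inner (fst x) (fst x) = 0" using inner_ge_zero by (rule antisym)
    then show ?thesis using that(2) by (simp add: prod_eq_iff)
  qed
  obtain u where u: "u \<in> Mov f" "u \<noteq> 0"
    using Mov subspace_0[OF sub] by blast
  then have snd: "snd u \<noteq> 0" using hyper by blast
  have "Mov f = span {u}"
  proof
    show "span {u} \<subseteq> Mov f" using u sub by (intro span_minimal) simp_all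
    show "Mov f \<subseteq> span {u}"
    proof
      fix x assume x: "x \<in> Mov f"
      \<comment> \<open>The multiple of \<open>u\<close> is chosen to cancel the last coordinate of
        \<open>x\<close>.\<close>
      have "x - (snd x / snd u) *\<^sub>R u = 0"
        using snd by (intro hyper subspace_diff subspace_scale sub x u) simp
      then have "x = (snd x / snd u) *\<^sub>R u" by simp
      then show "x \<in> span {u}" by (metis span_base span_scale singletonI)
    qed
  qed
  then have "wall_det f (Mov f) > 0 \<longleftrightarrow> Determinant.det (gram (wall_form f) [u]) > 0"
    using u(2) by (intro wall_det_pos_iff fO sub subset_refl) simp_all
  then show False
    using O_plusD(2)[OF f] neg[OF u(1)]
    by (simp add: det_gram_singleton wall_form_self[OF fO u(1)])
qed

section \<open>Reflection length as the dimension of the moved space\<close>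

lemma id_in_O_plus: "id \<in> O_plus"
proof -
  note sub = subspace_Mov[OF orthogonal_group_id]
  have "wall_det id (Mov id) > 0"
    by (subst wall_det_pos_iff[OF orthogonal_group_id sub subset_refl, of "[]"])
       (simp_all add: Mov_id det_gram_Nil)
  then show ?thesis
    unfolding O_plus_def using orthogonal_group_id by blast
qed

lemma Mov_eq_0_imp_id:
  assumes "Mov f = {0}"
  shows "f = id"
proof
  show "f x = id x" for x using MovI[of x f] assms by simp
qed

lemma foldr_comp_simps:
  "foldr (\<circ>) [] id = id" "foldr (\<circ>) (r # rs) id = r \<circ> foldr (\<circ>) rs id"
  by (rule ext; simp)+

text \<open>Induction on the dimension: the reflection along a moved vector with
  \<open>Q v > 0\<close> lowers it by exactly one and keeps the isometry positive.\<close>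

lemma O_plus_factorization:
  assumes "f \<in> O_plus"
  shows "\<exists>rs. length rs = dim (Mov f) \<and> set rs \<subseteq> positive_reflections \<and> f = foldr (\<circ>) rs id"
  using assms
proof (induction "dim (Mov f)" arbitrary: f)
  case 0
  then have "Mov f \<subseteq> {0}" by (metis dim_eq_0)
  then have "f = foldr (\<circ>) [] id"
    using subspace_0[OF subspace_Mov[OF O_plusD(1)[OF 0(2)]]] Mov_eq_0_imp_id[of f]
    unfolding foldr_comp_simps by blast
  moreover have "length [] = dim (Mov f)" "set [] \<subseteq> positive_reflections"
    using 0(1) by simp_all
  ultimately show ?case by blast
next
  case (Suc n)
  then have "Mov f \<noteq> {0}" by auto
  then obtain v where v: "v \<in> Mov f" "Q v > 0"
    using positive_vector_exists[OF Suc.prems] by blast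
  note fO = O_plusD(1)[OF Suc.prems]
  let ?h = "refl_along v \<circ> f"
  have dim: "dim (Mov f) = Suc (dim (Mov ?h))"
    by (rule dim_Mov_refl_along_comp[OF fO v(2,1)])
  moreover have "?h \<in> O_plus"
    using refl_along_comp_O_plus_iff[OF fO v(2)] Suc.prems by blast
  ultimately obtain rs where rs: "length rs = dim (Mov ?h)" "set rs \<subseteq> positive_reflections"
    "?h = foldr (\<circ>) rs id"
    using Suc.hyps by (metis Suc_inject)
  have "f = refl_along v \<circ> ?h"
    using v(2) by (simp add: comp_assoc[symmetric] refl_along_involution)
  then have "f = foldr (\<circ>) (refl_along v # rs) id"
    unfolding foldr_comp_simps rs(3)[symmetric] .
  moreover have "refl_along v \<in> positive_reflections"
    unfolding positive_reflections_def using v(2) by blast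
  ultimately show ?case
    using rs dim by (intro exI[of _ "refl_along v # rs"]) simp
qed

text \<open>Stands in for multiplicativity of the spinor norm. Membership in
  \<open>orthogonal_group\<close> is carried along because each further reflection is composed with
  an isometry.\<close>

lemma foldr_refl_comp_O_plus_iff:
  assumes "set rs \<subseteq> positive_reflections" and "h \<in> orthogonal_group"
  shows "foldr (\<circ>) rs id \<in> orthogonal_group
    \<and> (foldr (\<circ>) rs id \<circ> h \<in> O_plus \<longleftrightarrow> h \<in> O_plus)"
  using assms(1)
proof (induction rs)
  case Nil
  then show ?case
    unfolding foldr_comp_simps id_comp using orthogonal_group_id by blast
next
  case (Cons r rs)
  then obtain v where v: "r = refl_along v" "Q v > 0"
    by (auto simp: positive_reflections_def)
  have IH: "foldr (\<circ>) rs id \<in> orthogonal_group"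
    "foldr (\<circ>) rs id \<circ> h \<in> O_plus \<longleftrightarrow> h \<in> O_plus"
    using Cons.IH Cons.prems by (metis list.set_intros(2) subset_iff)+
  have "r \<in> orthogonal_group"
    using refl_along_orthogonal[of v] v by simp
  then show ?case
    using IH refl_along_comp_O_plus_iff[OF orthogonal_group_comp[OF IH(1) assms(2)] v(2)]
    unfolding foldr_comp_simps comp_assoc v(1) by (blast intro: orthogonal_group_comp)
qed

text \<open>Writing \<open>g\<close> as a product of positive reflections allows it to be cancelled
  from \<open>g \<circ> (inv_into UNIV g \<circ> f) = f\<close> without affecting
  positivity.\<close>

lemma O_plus_inv_comp:
  assumes g: "g \<in> O_plus" and f: "f \<in> O_plus"
  shows "inv_into UNIV g \<circ> f \<in> O_plus" "g \<circ> (inv_into UNIV g \<circ> f) = f"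
proof -
  note gO = O_plusD(1)[OF g] and fO = O_plusD(1)[OF f]
  show eq: "g \<circ> (inv_into UNIV g \<circ> f) = f"
    using orthogonal_groupD(2)[OF gO]
    by (simp add: fun_eq_iff bij_is_surj surj_f_inv_f)
  obtain rs where rs: "set rs \<subseteq> positive_reflections" "g = foldr (\<circ>) rs id"
    using O_plus_factorization[OF g] by blast
  then have "g \<circ> (inv_into UNIV g \<circ> f) \<in> O_plus \<longleftrightarrow> inv_into UNIV g \<circ> f \<in> O_plus"
    using foldr_refl_comp_O_plus_iff[OF rs(1)
        orthogonal_group_comp[OF orthogonal_group_inv[OF gO] fO]] by metis
  then show "inv_into UNIV g \<circ> f \<in> O_plus" using f by (simp only: eq)
qed

text \<open>Each reflection adds at most one dimension; this is the lower bound for the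
  length.\<close>

lemma dim_Mov_foldr_refl_le:
  assumes "set rs \<subseteq> positive_reflections"
  shows "dim (Mov (foldr (\<circ>) rs id)) \<le> length rs"
  using assms
proof (induction rs)
  case Nil
  show ?case unfolding foldr_comp_simps Mov_id by simp
next
  case (Cons r rs)
  then obtain v where v: "r = refl_along v" "Q v > 0"
    by (auto simp: positive_reflections_def)
  then have "dim (Mov r) \<le> 1" by (simp add: Mov_refl_along)
  moreover have "r \<in> orthogonal_group"
    using refl_along_orthogonal[of v] v by simp
  moreover have "foldr (\<circ>) rs id \<in> orthogonal_group"
    using foldr_refl_comp_O_plus_iff[OF _ orthogonal_group_id] Cons.prems
    by (metis list.set_intros(2) subset_iff)
  moreover have "dim (Mov (foldr (\<circ>) rs id)) \<le> length rs"
    using Cons.IH Cons.prems by (metis list.set_intros(2) subset_iff)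
  ultimately show ?case
    using dim_Mov_comp_le[of r "foldr (\<circ>) rs id"] unfolding foldr_comp_simps list.size by linarith
qed

lemma l_plus_eq_dim_Mov:
  assumes "f \<in> O_plus"
  shows "l_plus f = dim (Mov f)"
  unfolding l_plus_def
proof (rule Least_equality)
  show "\<exists>rs. length rs = dim (Mov f) \<and> set rs \<subseteq> positive_reflections \<and> f = foldr (\<circ>) rs id"
    by (rule O_plus_factorization[OF assms])
  show "dim (Mov f) \<le> k"
    if "\<exists>rs. length rs = k \<and> set rs \<subseteq> positive_reflections \<and> f = foldr (\<circ>) rs id" for k
    using that dim_Mov_foldr_refl_le by metis
qed

text \<open>With lengths read as dimensions, \<open>le_plus g f\<close> says that dimensions add in
  \<open>f = g \<circ> h\<close>, that is, that this factorization is direct.\<close>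

lemma le_plus_iff:
  assumes g: "g \<in> O_plus" and f: "f \<in> O_plus"
  shows "le_plus g f \<longleftrightarrow>
    Mov g \<subseteq> Mov f \<and> (\<forall>u\<in>Mov g. \<forall>v\<in>Mov g. wall_form g u v = wall_form f u v)"
proof -
  let ?h = "inv_into UNIV g \<circ> f"
  note gO = O_plusD(1)[OF g] and fO = O_plusD(1)[OF f]
  have h: "?h \<in> O_plus" and f_eq: "f = g \<circ> ?h"
    using O_plus_inv_comp[OF g f] by simp_all
  note hO = O_plusD(1)[OF h]
  have le: "le_plus g f \<longleftrightarrow> dim (Mov f) = dim (Mov g) + dim (Mov ?h)"
    by (simp only: le_plus_def l_plus_eq_dim_Mov f g h)
  show ?thesis
  proof
    assume "le_plus g f"
    then have "dim (Mov g \<inter> Mov ?h) = 0"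
      using dim_Mov_comp_le[OF gO hO, folded f_eq] le by linarith
    then have Int: "Mov g \<inter> Mov ?h \<subseteq> {0}" by (simp only: dim_eq_0)
    show "Mov g \<subseteq> Mov f \<and> (\<forall>u\<in>Mov g. \<forall>v\<in>Mov g. wall_form g u v = wall_form f u v)"
      using Mov_subset_Mov_comp(1)[OF gO hO Int, folded f_eq]
        wall_form_comp_left(1)[OF gO hO Int, folded f_eq] by metis
  next
    assume "Mov g \<subseteq> Mov f \<and> (\<forall>u\<in>Mov g. \<forall>v\<in>Mov g. wall_form g u v = wall_form f u v)"
    then have "Mov g \<inter> Mov ?h \<subseteq> {0}"
      by (intro Mov_Int_complement[OF fO gO hO f_eq]) blast+
    then show "le_plus g f"
      using dim_Mov_comp[OF gO hO, folded f_eq] le by blast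
  qed
qed

section \<open>The interval and its image under \<open>Mov\<close>\<close>

lemma interval_id_eq:
  "interval_id f = {h \<in> O_plus. le_plus h f}"
proof -
  \<comment> \<open>The moved space of \<open>id\<close> is zero, and both Wall forms vanish there
    because \<open>Q 0 = 0\<close>.\<close>
  have "le_plus id h" if "h \<in> O_plus" for h :: "'n::finite lorentz \<Rightarrow> 'n lorentz"
    using le_plus_iff[OF id_in_O_plus that] subspace_0[OF subspace_Mov[OF O_plusD(1)[OF that]]]
      wall_form_self[OF orthogonal_group_id, of 0] wall_form_self[OF O_plusD(1)[OF that], of 0]
    by (simp add: Mov_id)
  then show ?thesis unfolding interval_id_def by blast
qed

theorem theorem5p3:
  fixes f :: "'n::finite lorentz \<Rightarrow> 'n lorentz"
  assumes "f \<in> O_plus"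
  shows "poset_isomorphic
           (interval_id f) le_plus
           {U. subspace U \<and> U \<subseteq> Mov f \<and> wall_det f U > 0} (\<subseteq>)"
proof -
  note fO = O_plusD(1)[OF assms]
  let ?P = "{U. subspace U \<and> U \<subseteq> Mov f \<and> wall_det f U > 0}"
  have intervalD: "g \<in> O_plus" "g \<in> orthogonal_group" "Mov g \<subseteq> Mov f"
    "\<And>u v. u \<in> Mov g \<Longrightarrow> v \<in> Mov g \<Longrightarrow> wall_form g u v = wall_form f u v"
    if "g \<in> interval_id f" for g
    using that le_plus_iff[OF _ assms] O_plusD(1) unfolding interval_id_eq by blast+
  \<comment> \<open>Both Wall forms are restrictions of that of \<open>f\<close>, so they agree
    wherever both are defined and inclusion alone decides the order.\<close>
  have le: "le_plus g h \<longleftrightarrow> Mov g \<subseteq> Mov h" if gh: "g \<in> interval_id f" "h \<in> interval_id f" for g h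
    using le_plus_iff[OF intervalD(1)[OF gh(1)] intervalD(1)[OF gh(2)]]
      intervalD(4)[OF gh(1)] intervalD(4)[OF gh(2)] by (metis subsetD)
  \<comment> \<open>Equal moved spaces carry equal Wall forms, both restricted from
    \<open>f\<close>, and these data determine the isometry.\<close>
  have "inj_on Mov (interval_id f)"
    using intervalD by (intro inj_onI orthogonal_group_eqI) metis+
  moreover have "Mov ` interval_id f = ?P"
  proof
    show "Mov ` interval_id f \<subseteq> ?P"
    proof
      fix U assume "U \<in> Mov ` interval_id f"
      then obtain g where g: "g \<in> interval_id f" "U = Mov g" by blast
      note sub = subspace_Mov[OF intervalD(2)[OF g(1)]]
      have "wall_det g (Mov g) = wall_det f (Mov g)"
        by (intro wall_det_cong sub intervalD(4)[OF g(1)])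
      then show "U \<in> ?P"
        using O_plusD(2)[OF intervalD(1)[OF g(1)]] intervalD(3)[OF g(1)] sub g(2) by simp
    qed
    show "?P \<subseteq> Mov ` interval_id f"
    proof
      fix U assume "U \<in> ?P"
      then have U: "subspace U" "U \<subseteq> Mov f" "wall_det f U > 0" by simp_all
      obtain g where g: "g \<in> orthogonal_group" "Mov g = U"
        "\<And>u v. u \<in> U \<Longrightarrow> v \<in> U \<Longrightarrow> wall_form g u v = wall_form f u v"
        using isometry_with_Mov_exists[OF fO U] by blast
      have "wall_det g U = wall_det f U"
        by (intro wall_det_cong U(1) g(3))
      then have "g \<in> O_plus" using g(1,2) U(3) by (simp add: O_plus_def)
      then have "g \<in> interval_id f"
        using le_plus_iff[OF _ assms] g U(2) unfolding interval_id_eq by blast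
      then show "U \<in> Mov ` interval_id f" using g(2) by blast
    qed
  qed
  ultimately show ?thesis
    unfolding poset_isomorphic_def using le by (intro exI[of _ Mov]) (simp add: bij_betw_def)
qed

end
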